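(* Let $N\geq 1$ be an integer, let $\omega(x)=\exp(-x^2/(2N))$ for $x\in\mathbb{R}$, and let $\{q_k\}_{k\geq 0}$ be the orthogonal polynomials with respect to the weight $\omega$. Then, for every $n\geq 1$ and all $x_1,\ldots,x_n\in\mathbb{R}$, the $n$-point correlation function $\rho^{(n)}_{\rm GUE}$ of the eigenvalues of an $N\times N$ GUE random matrix satisfies $$\rho^{(n)}_{\rm GUE}(x_1,\ldots,x_n)=\det\left[K_N^{\rm GUE}(x_i,x_j)\right]_{1\leq i,j\leq n},$$ where $$K_N^{\rm GUE}(x,y)=\sqrt{\omega(x)}\,\sqrt{\omega(y)}\,\sum_{k=0}^{N-1} q_k(x)\,q_k(y).$$
   Context: GUE eigenvalue density. The (unordered) eigenvalues $\lambda_1,\ldots,\lambda_N\in\mathbb{R}$ of an $N\times N$ random matrix from the Gaussian Unitary Ensemble (probability measure on $N\times N$ complex Hermitian matrices proportional to $\exp(-\frac{1}{2N}\mathrm{Tr}(H^2))\,\mathrm{d}H$, with $\mathrm{d}H=\prod_{i}\mathrm{d}H_{i,i}\prod_{i<j}\mathrm{d}\,\mathrm{Re}(H_{i,j})\,\mathrm{d}\,\mathrm{Im}(H_{i,j})$) have joint probability density with respect to Lebesgue measure on $\mathbb{R}^N$ given by $$P_{\rm GUE}(\lambda_1,\ldots,\lambda_N)=\frac{1}{Z_N}\prod_{1\leq i<j\leq N}(\lambda_j-\lambda_i)^2\prod_{i=1}^N e^{-\lambda_i^2/(2N)},$$ where $Z_N$ is the normalization constant making this a probability density. This density is symmetric under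 permutations of the variables. Correlation functions. The $n$-point correlation function (with Lebesgue reference measure) is the density of finding an eigenvalue at each of the points $x_1,\ldots,x_n$, without specifying which eigenvalue is at which position; explicitly, $$\rho^{(n)}_{\rm GUE}(x_1,\ldots,x_n)=\frac{N!}{(N-n)!}\int_{\mathbb{R}^{N-n}}P_{\rm GUE}(x_1,\ldots,x_N)\,\mathrm{d}x_{n+1}\cdots \mathrm{d}x_N\quad\text{for } 1\leq n\leq N$$ (no integration when $n=N$), and $\rho^{(n)}_{\rm GUE}(x_1,\ldots,x_n)=0$ for $n>N$. Orthogonal polynomials. Given a weight $\omega:\mathbb{R}\to\mathbb{R}_+$, the orthogonal polynomials $\{q_k\}_{k\geq 0}$ with respect to $\omega$ are defined by: (1) $q_k$ is a real polynomial of degree $k$ with leading coefficient $u_k>0$; (2) they are orthonormal, i.e. $\int_{\mathbb{R}}\omega(x)q_k(x)q_l(x)\,\mathrm{d}x=\delta_{k,l}$ for all $k,l\geq 0$. *)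

theory Defs
  imports "HOL-Analysis.Analysis" "Jordan_Normal_Form.Determinant"
begin

text \<open>
  Points of \<open>\<real>\<^sup>N\<close> are functions \<open>nat \<Rightarrow> real\<close> of which only the coordinates \<open>0, \<dots>, N - 1\<close>
  matter (the informal indices \<open>1, \<dots>, N\<close> are shifted by one), and Lebesgue measure on \<open>\<real>\<^sup>N\<close>
  is the product measure \<open>\<Pi>\<^sub>M i\<in>{..<N}. lborel\<close>.
\<close>

definition gue_weight :: "nat \<Rightarrow> real \<Rightarrow> real" where
  "gue_weight N x = exp (- x\<^sup>2 / (2 * real N))"

definition gue_unnormalized :: "nat \<Rightarrow> (nat \<Rightarrow> real) \<Rightarrow> real" where
  "gue_unnormalized N l =
     (\<Prod>j<N. \<Prod>i<j. (l j - l i)\<^sup>2) * (\<Prod>i<N. exp (- (l i)\<^sup>2 / (2 * real N)))"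

definition gue_Z :: "nat \<Rightarrow> real" where
  "gue_Z N = (LINT l|(\<Pi>\<^sub>M i\<in>{..<N}. lborel). gue_unnormalized N l)"

definition gue_density :: "nat \<Rightarrow> (nat \<Rightarrow> real) \<Rightarrow> real" where
  "gue_density N l = gue_unnormalized N l / gue_Z N"

text \<open>
  Here \<open>merge {..<n} {n..<N} (x, y)\<close> is the point \<open>(x\<^sub>0, \<dots>, x\<^sub>n\<^sub>-\<^sub>1, y\<^sub>n, \<dots>, y\<^sub>N\<^sub>-\<^sub>1)\<close>. For \<open>n = N\<close> the
  integral is over the one-point space \<open>\<Pi>\<^sub>M i\<in>{}. lborel\<close> of mass 1, so it is just the value of
  the density at \<open>x\<close>.
\<close>

definition gue_correlation :: "nat \<Rightarrow> nat \<Rightarrow> (nat \<Rightarrow> real) \<Rightarrow> real" where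
  "gue_correlation N n x =
     (if n \<le> N then
        fact N / fact (N - n) *
          (LINT y|(\<Pi>\<^sub>M i\<in>{n..<N}. lborel). gue_density N (merge {..<n} {n..<N} (x, y)))
      else 0)"

definition orthogonal_polynomials :: "(real \<Rightarrow> real) \<Rightarrow> (nat \<Rightarrow> real poly) \<Rightarrow> bool" where
  "orthogonal_polynomials w q \<longleftrightarrow>
     (\<forall>k. degree (q k) = k \<and> lead_coeff (q k) > 0) \<and>
     (\<forall>k l. has_bochner_integral lborel (\<lambda>x. w x * poly (q k) x * poly (q l) x)
              (if k = l then 1 else 0))"

definition gue_kernel :: "nat \<Rightarrow> (nat \<Rightarrow> real poly) \<Rightarrow> real \<Rightarrow> real \<Rightarrow> real" where
  "gue_kernel N q x y =
     sqrt (gue_weight N x) * sqrt (gue_weight N y) * (\<Sum>k<N. poly (q k) x * poly (q k) y)"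

end

theory Submission
  imports Defs
begin

text \<open>
  With \<open>\<phi>\<^sub>k = \<surd>\<omega> q\<^sub>k\<close> orthonormal, the kernel \<open>K(s, t) = \<Sum>\<^sub>k \<phi>\<^sub>k(s) \<phi>\<^sub>k(t)\<close> is reproducing and has
  trace \<open>N\<close>. Let \<open>D\<^sub>n = det [K(x\<^sub>i, x\<^sub>j)]\<close> of size \<open>n\<close>. Expanding \<open>D\<^sub>n\<^sub>+\<^sub>1\<close> along its last row and
  column and integrating over the last variable gives \<open>N D\<^sub>n\<close> minus the sum of all entries times
  their cofactors, that is \<open>(N - n) D\<^sub>n\<close>. Hence integrating \<open>D\<^sub>N\<close> over its last \<open>N - n\<close> variables
  gives \<open>(N - n)! D\<^sub>n\<close>. On the other hand \<open>D\<^sub>N = (det [\<phi>\<^sub>k(x\<^sub>i)])\<^sup>2\<close> is, by Vandermonde, a constant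
  multiple of the GUE weight, and the case \<open>n = 0\<close> identifies the constant. For \<open>n > N\<close> the
  matrix has rank at most \<open>N\<close>, so \<open>D\<^sub>n = 0\<close>.
\<close>

section \<open>Cofactor expansions\<close>

text \<open>After expansion along the last column, each cofactor of an entry above the corner is
  expanded along the last row of \<open>A\<close>. All dependence on that row and column becomes
  explicit, ready for termwise integration.\<close>

lemma bordered_det:
  fixes A :: "'a :: comm_ring_1 mat"
  assumes A: "A \<in> carrier_mat (Suc n) (Suc n)"
  defines "B \<equiv> mat_delete A n n"
  shows "Determinant.det A = A $$ (n, n) * Determinant.det B -
    (\<Sum>i<n. \<Sum>j<n. A $$ (i, n) * A $$ (n, j) * cofactor B i j)"
proof -
  have cof: "cofactor A i n = - (\<Sum>j<n. A $$ (n, j) * cofactor B i j)" if i: "i < n" for i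
  proof -
    obtain m where n: "n = Suc m" using i by (cases n) auto
    let ?C = "mat_delete A i n"
    have C: "?C \<in> carrier_mat n n" using mat_delete_carrier[OF A] by simp
    have "cofactor A i n = (-1) ^ (i + n) * (\<Sum>j<n. ?C $$ (m, j) * cofactor ?C m j)"
      unfolding cofactor_def[of A] using laplace_expansion_row[OF C, of m] n by simp
    also have "\<dots> = (\<Sum>j<n. - (A $$ (n, j) * cofactor B i j))"
      unfolding sum_distrib_left
    proof (rule sum.cong[OF refl])
      fix j assume "j \<in> {..<n}"
      then have j: "j < n" by simp
      have el: "?C $$ (m, j) = A $$ (n, j)"
        using A i j n by (auto simp: mat_delete_def)
      have del: "mat_delete ?C m j = mat_delete B i j"
        by (rule eq_matI) (use A i j n in \<open>auto simp: B_def mat_delete_def\<close>)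
      \<comment> \<open>Row \<open>n\<close> of \<open>A\<close> sits at position
        \<open>m = n - 1\<close> in \<open>?C\<close>; this shift by one produces the minus
        sign.\<close>
      have sgn: "(-1) ^ (i + n) * (-1) ^ (m + j) = - ((-1) ^ (i + j) :: 'a)"
      proof -
        have "i + n + (m + j) = Suc (i + j + 2 * m)" using n by simp
        then show ?thesis
          by (simp only: power_add[symmetric]) (simp add: power_add power_mult)
      qed
      show "(-1) ^ (i + n) * (?C $$ (m, j) * cofactor ?C m j) = - (A $$ (n, j) * cofactor B i j)"
        unfolding el cofactor_def del using sgn
        by (metis (no_types, lifting) mult.assoc mult.left_commute mult_minus_left)
    qed
    finally show ?thesis by (simp add: sum_negf)
  qed
  have "Determinant.det A = (\<Sum>i<Suc n. A $$ (i, n) * cofactor A i n)"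
    using laplace_expansion_column[OF A, of n] by simp
  also have "\<dots> = A $$ (n, n) * Determinant.det B + (\<Sum>i<n. A $$ (i, n) * cofactor A i n)"
    by (simp add: cofactor_def B_def mult_2[symmetric] power_add[symmetric])
  also have "(\<Sum>i<n. A $$ (i, n) * cofactor A i n) =
      - (\<Sum>i<n. \<Sum>j<n. A $$ (i, n) * A $$ (n, j) * cofactor B i j)"
    by (simp add: cof sum_distrib_left sum_negf mult.assoc)
  finally show ?thesis by simp
qed

text \<open>Each of the \<open>n\<close> rows contributes one Laplace expansion of the
  determinant.\<close>

lemma sum_cofactor_eq_det:
  fixes A :: "'a :: comm_ring_1 mat"
  assumes A: "A \<in> carrier_mat n n"
  shows "(\<Sum>i<n. \<Sum>j<n. A $$ (i, j) * cofactor A i j) = of_nat n * Determinant.det A"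
  using laplace_expansion_row[OF A, symmetric] by simp

lemma det_mat_mult_rows:
  fixes c :: "nat \<Rightarrow> 'a :: comm_ring_1"
  shows "Determinant.det (Matrix.mat n n (\<lambda>(i, j). c i * f i j)) =
    (\<Prod>i<n. c i) * Determinant.det (Matrix.mat n n (\<lambda>(i, j). f i j))"
proof -
  have "(\<Prod>i = 0..<n. Matrix.mat n n (\<lambda>(i, j). c i * f i j) $$ (i, p i)) =
      (\<Prod>i<n. c i) * (\<Prod>i = 0..<n. Matrix.mat n n (\<lambda>(i, j). f i j) $$ (i, p i))"
    if "p permutes {0..<n}" for p
    using permutes_in_image[OF that]
    by (simp add: lessThan_atLeast0 prod.distrib[symmetric])
  then show ?thesis
    by (simp add: det_def'[where n = n] sum_distrib_left mult.left_commute)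
qed

section \<open>Vandermonde determinants in a polynomial basis\<close>

lemma det_poly_eq_Vandermonde:
  fixes q :: "nat \<Rightarrow> 'a :: idom poly" and x :: "nat \<Rightarrow> 'a"
  assumes deg: "\<And>k. k < n \<Longrightarrow> degree (q k) = k"
  shows "Determinant.det (Matrix.mat n n (\<lambda>(i, k). poly (q k) (x i))) =
    (\<Prod>k<n. lead_coeff (q k)) * (\<Prod>j<n. \<Prod>i<j. x j - x i)"
  using deg
proof (induction n)
  case 0
  show ?case by simp
next
  case (Suc n)
  define A where "A = Matrix.mat (Suc n) (Suc n) (\<lambda>(i, k). poly (q k) (x i))"
  have A: "A \<in> carrier_mat (Suc n) (Suc n)" by (simp add: A_def)
  show ?case
  \<comment> \<open>Repeated nodes are split off because the root count below needs \<open>n\<close>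
    distinct nodes.\<close>
  proof (cases "inj_on x {..<n}")
    case False
    then obtain i j where ij: "i < n" "j < n" "i \<noteq> j" "x i = x j"
      by (auto simp: inj_on_def)
    have "Determinant.det A = 0"
      by (rule det_identical_rows[OF A \<open>i \<noteq> j\<close>]) (use ij in \<open>auto simp: A_def row_def\<close>)
    moreover have "(\<Prod>j<n. \<Prod>i<j. x j - x i) = 0"
    proof -
      have "\<exists>j<n. \<exists>i<j. x j - x i = 0"
        using ij by (metis linorder_neqE_nat right_minus_eq)
      then show ?thesis by (auto simp: prod_zero_iff)
    qed
    ultimately show ?thesis by (simp add: A_def)
  next
    case inj: True
    \<comment> \<open>As a polynomial in its last node, the determinant has degree at most \<open>n\<close> and vanishes at
      the other nodes, so it is determined by its leading coefficient.\<close>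
    define D where "D = Determinant.det (Matrix.mat n n (\<lambda>(i, k). poly (q k) (x i)))"
    define p where "p = (\<Sum>k<Suc n. Polynomial.smult (cofactor A n k) (q k))"
    define r where "r = Polynomial.smult (D * lead_coeff (q n)) (\<Prod>i<n. [:- x i, 1:])"
    \<comment> \<open>Cofactors along row \<open>n\<close> do not involve the last node, so those of
      \<open>A\<close> serve for every \<open>t\<close>.\<close>
    have poly_p: "poly p t = Determinant.det
      (Matrix.mat (Suc n) (Suc n) (\<lambda>(i, k). poly (q k) (if i = n then t else x i)))" for t
    proof -
      let ?B = "Matrix.mat (Suc n) (Suc n) (\<lambda>(i, k). poly (q k) (if i = n then t else x i))"
      have B: "?B \<in> carrier_mat (Suc n) (Suc n)" by simp
      have "cofactor ?B n k = cofactor A n k" if "k < Suc n" for k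
      proof -
        have "mat_delete ?B n k = mat_delete A n k"
          by (rule eq_matI) (auto simp: mat_delete_def A_def)
        then show ?thesis by (simp add: cofactor_def)
      qed
      then show ?thesis
        unfolding laplace_expansion_row[OF B lessI]
        by (auto simp: p_def poly_sum mult.commute simp del: sum.lessThan_Suc intro!: sum.cong)
    qed
    have deg_r: "degree (\<Prod>i<n. [:- x i, 1:]) = n"
      by (subst degree_prod_eq_sum_degree) auto
    have lead: "coeff (\<Prod>i<n. [:- x i, 1:]) n = 1"
      using lead_coeff_prod[of "\<lambda>i. [:- x i, 1:]" "{..<n}"] deg_r by simp
    have "cofactor A n n = D"
    proof -
      have "mat_delete A n n = Matrix.mat n n (\<lambda>(i, k). poly (q k) (x i))"
        by (rule eq_matI) (auto simp: mat_delete_def A_def)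
      then show ?thesis by (simp add: cofactor_def D_def)
    qed
    \<comment> \<open>Only \<open>q n\<close> reaches degree \<open>n\<close> in \<open>p\<close>;
      \<open>r\<close> was scaled to match its coefficient there.\<close>
    then have "coeff (p - r) n = 0"
      using Suc.prems by (simp add: p_def r_def lead coeff_sum coeff_eq_0)
    moreover have "degree (p - r) \<le> n"
    proof (rule degree_diff_le)
      show "degree p \<le> n"
        unfolding p_def
        by (intro degree_sum_le order.trans[OF degree_smult_le]) (use Suc.prems in auto)
      show "degree r \<le> n"
        unfolding r_def using order.trans[OF degree_smult_le] deg_r by simp
    qed
    \<comment> \<open>The zero polynomial has degree 0, which is not below \<open>n\<close> when
      \<open>n = 0\<close>; hence the restriction.\<close>
    ultimately have deg_lt: "degree (p - r) < n" if "p - r \<noteq> 0"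
      using that by (metis le_neq_implies_less leading_coeff_0_iff)
    have eq: "poly p (x i) = poly r (x i)" if i: "i < n" for i
    proof -
      have "poly p (x i) = 0"
        unfolding poly_p
        by (rule det_identical_rows[of _ "Suc n" i n]) (use i in \<open>auto simp: row_def\<close>)
      moreover have "poly r (x i) = 0"
        using i by (auto simp: r_def poly_prod prod_zero_iff)
      ultimately show ?thesis by simp
    qed
    have "p - r = 0"
    proof (rule ccontr)
      assume nz: "p - r \<noteq> 0"
      have "card (x ` {..<n}) \<le> card {t. poly (p - r) t = 0}"
        using eq by (intro card_mono poly_roots_finite nz) auto
      also have "\<dots> \<le> degree (p - r)"
        using nz by (rule card_poly_roots_bound)
      finally show False using card_image[OF inj] deg_lt[OF nz] by simp
    qed
    then have "p = r" by simp
    have "Matrix.mat (Suc n) (Suc n) (\<lambda>(i, k). poly (q k) (if i = n then x n else x i)) = A"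
      by (rule eq_matI) (auto simp: A_def)
    then have "Determinant.det A = poly r (x n)"
      using poly_p[of "x n"] \<open>p = r\<close> by simp
    then show ?thesis
      using Suc by (simp add: A_def r_def poly_prod D_def)
  qed
qed


section \<open>Kernel determinants of orthonormal functions\<close>

text \<open>Integrating out variables rests on orthonormality and, for Fubini, sigma-finiteness; the
  weight enters only through the choice of \<open>\<phi>\<close>.\<close>

locale orthonormal_functions = sigma_finite_measure M
  for M :: "'a measure" +
  fixes \<phi> :: "nat \<Rightarrow> 'a \<Rightarrow> real" and N :: nat
  assumes orthonormal: "k < N \<Longrightarrow> l < N \<Longrightarrow>
    has_bochner_integral M (\<lambda>t. \<phi> k t * \<phi> l t) (of_bool (k = l))"
begin

text \<open>For measurable \<open>\<phi> k\<close> this is the integral kernel of the orthogonal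
  projection onto the span of the first \<open>N\<close> functions.\<close>

definition kernel :: "'a \<Rightarrow> 'a \<Rightarrow> real" where
  "kernel s t = (\<Sum>k<N. \<phi> k s * \<phi> k t)"

definition kernel_det :: "nat \<Rightarrow> (nat \<Rightarrow> 'a) \<Rightarrow> real" where
  "kernel_det n x = Determinant.det (Matrix.mat n n (\<lambda>(i, j). kernel (x i) (x j)))"

lemma kernel_diag_integral: "has_bochner_integral M (\<lambda>t. kernel t t) (real N)"
proof -
  have "has_bochner_integral M (\<lambda>t. \<Sum>k<N. \<phi> k t * \<phi> k t) (\<Sum>k<N. of_bool (k = k))"
    by (intro has_bochner_integral_sum orthonormal) auto
  then show ?thesis by (simp add: kernel_def)
qed

text \<open>Idempotence of the projection: orthonormality leaves only the terms \<open>k = l\<close>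
  of the double sum.\<close>

lemma kernel_reproducing: "has_bochner_integral M (\<lambda>t. kernel a t * kernel t b) (kernel a b)"
proof -
  have "has_bochner_integral M
      (\<lambda>t. \<Sum>k<N. \<Sum>l<N. (\<phi> k a * \<phi> l b) * (\<phi> k t * \<phi> l t))
      (\<Sum>k<N. \<Sum>l<N. (\<phi> k a * \<phi> l b) * of_bool (k = l))"
    by (intro has_bochner_integral_sum has_bochner_integral_mult_right orthonormal) auto
  moreover have "(\<Sum>k<N. \<Sum>l<N. (\<phi> k a * \<phi> l b) * of_bool (k = l)) = kernel a b"
    by (simp add: kernel_def of_bool_def if_distrib cong: if_cong)
  moreover have "(\<lambda>t. \<Sum>k<N. \<Sum>l<N. (\<phi> k a * \<phi> l b) * (\<phi> k t * \<phi> l t)) =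
      (\<lambda>t. kernel a t * kernel t b)"
    by (simp add: kernel_def sum_product mult_ac)
  ultimately show ?thesis by simp
qed

text \<open>The trace contributes \<open>N\<close>; the reproducing property turns the border
  products back into matrix entries, which summed against their cofactors contribute
  \<open>- n\<close>.\<close>

lemma kernel_det_integral_last:
  "has_bochner_integral M (\<lambda>t. kernel_det (Suc n) (x(n := t)))
     ((real N - real n) * kernel_det n x)"
proof -
  define B where "B = Matrix.mat n n (\<lambda>(i, j). kernel (x i) (x j))"
  have B: "B \<in> carrier_mat n n" by (simp add: B_def)
  have expand: "kernel_det (Suc n) (x(n := t)) = kernel t t * kernel_det n x -
      (\<Sum>i<n. \<Sum>j<n. kernel (x i) t * kernel t (x j) * cofactor B i j)" for t
  proof -
    let ?A = "Matrix.mat (Suc n) (Suc n) (\<lambda>(i, j). kernel ((x(n := t)) i) ((x(n := t)) j))"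
    have "mat_delete ?A n n = B"
      by (rule eq_matI) (auto simp: mat_delete_def B_def)
    then show ?thesis
      using bordered_det[of ?A n] by (simp add: kernel_det_def B_def)
  qed
  have "has_bochner_integral M (\<lambda>t. kernel_det (Suc n) (x(n := t)))
      (real N * kernel_det n x - (\<Sum>i<n. \<Sum>j<n. kernel (x i) (x j) * cofactor B i j))"
    unfolding expand
    by (intro has_bochner_integral_diff has_bochner_integral_sum has_bochner_integral_mult_left
        kernel_reproducing kernel_diag_integral)
  moreover have "(\<Sum>i<n. \<Sum>j<n. kernel (x i) (x j) * cofactor B i j) = real n * kernel_det n x"
    using sum_cofactor_eq_det[OF B] by (simp add: kernel_det_def B_def)
  ultimately show ?thesis by (simp add: algebra_simps)
qed

text \<open>Padding the \<open>n \<times> N\<close> factor of the kernel matrix with zero columns makes it square.\<close>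

lemma kernel_det_eq_square:
  assumes "N \<le> n"
  shows "kernel_det n x =
    (Determinant.det (Matrix.mat n n (\<lambda>(i, k). if k < N then \<phi> k (x i) else 0)))\<^sup>2"
proof -
  define A where "A = Matrix.mat n n (\<lambda>(i, k). if k < N then \<phi> k (x i) else 0)"
  have A: "A \<in> carrier_mat n n" by (simp add: A_def)
  have "{k. k < N} \<inter> {0..<n} = {..<N}" "{0..<n} \<inter> {k. k < N} = {..<N}" using assms by auto
  then have "Matrix.mat n n (\<lambda>(i, j). kernel (x i) (x j)) = A * A\<^sup>T"
    by (intro eq_matI) (auto simp: A_def kernel_def scalar_prod_def if_distrib if_distribR
        sum.If_cases cong: if_cong)
  then show ?thesis
    using det_mult[OF A, of "A\<^sup>T"] det_transpose[OF A] A
    by (simp add: kernel_det_def A_def power2_eq_square)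
qed

text \<open>Column \<open>N\<close> of the padded factor is zero, so expansion along it gives
  0.\<close>

lemma kernel_det_eq_0:
  assumes "N < n"
  shows "kernel_det n x = 0"
proof -
  let ?A = "Matrix.mat n n (\<lambda>(i, k). if k < N then \<phi> k (x i) else 0)"
  have "Determinant.det ?A = (\<Sum>i<n. ?A $$ (i, N) * cofactor ?A i N)"
    using assms by (intro laplace_expansion_column) auto
  also have "\<dots> = 0" using assms by (intro sum.neutral) auto
  finally show ?thesis using assms by (simp add: kernel_det_eq_square)
qed

text \<open>\<open>merge\<close> is \<open>undefined\<close> outside its two index sets, so points
  are compared only on the coordinates entering the matrix.\<close>

lemma kernel_det_cong: "(\<And>i. i < n \<Longrightarrow> x i = y i) \<Longrightarrow> kernel_det n x = kernel_det n y"
  unfolding kernel_det_def by (intro arg_cong[of _ _ Determinant.det] eq_matI) auto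

section \<open>Integrating out variables\<close>

text \<open>The Leibniz formula for both factors of the squared determinant gives a finite sum of
  products of one-variable functions \<open>\<phi> k t * \<phi> l t\<close>, each integrable. Fubini
  below relies on this.\<close>

lemma kernel_det_integrable:
  "integrable (\<Pi>\<^sub>M i\<in>{n..<N}. M) (\<lambda>y. kernel_det N (merge {..<n} {n..<N} (x, y)))"
proof -
  interpret product_sigma_finite "\<lambda>_::nat. M" ..
  let ?P = "{p. p permutes {0..<N}}"
  let ?z = "\<lambda>y. merge {..<n} {n..<N} (x, y)"
  have perm: "p i < N" if "p \<in> ?P" "i < N" for p i
    using that permutes_in_image[of p "{0..<N}" i] by auto
  have int: "integrable (\<Pi>\<^sub>M i\<in>{n..<N}. M) (\<lambda>y. \<Prod>i = 0..<N. \<phi> (p i) (?z y i) * \<phi> (r i) (?z y i))"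
    if "p \<in> ?P" "r \<in> ?P" for p r
  proof -
    \<comment> \<open>For \<open>n > N\<close> the set of integrated variables is empty, and
      \<open>min\<close> confines the fixed ones to indices below \<open>N\<close>.\<close>
    have split: "{0..<N} = {0..<min n N} \<union> {n..<N}" by auto
    have "(\<Prod>i = 0..<N. \<phi> (p i) (?z y i) * \<phi> (r i) (?z y i)) =
        (\<Prod>i = 0..<min n N. \<phi> (p i) (x i) * \<phi> (r i) (x i)) *
        (\<Prod>i\<in>{n..<N}. \<phi> (p i) (y i) * \<phi> (r i) (y i))" for y
      by (subst split, subst prod.union_disjoint)
         (auto simp: merge_def intro!: arg_cong2[of _ _ _ _ "(*)"] prod.cong)
    moreover have "integrable (\<Pi>\<^sub>M i\<in>{n..<N}. M) (\<lambda>y. \<Prod>i\<in>{n..<N}. \<phi> (p i) (y i) * \<phi> (r i) (y i))"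
      using that perm orthonormal
      by (intro product_integrable_prod) (auto simp: has_bochner_integral_iff)
    ultimately show ?thesis by simp
  qed
  have "kernel_det N z = (\<Sum>p\<in>?P. \<Sum>r\<in>?P. (signof p * signof r) *
      (\<Prod>i = 0..<N. \<phi> (p i) (z i) * \<phi> (r i) (z i)))" for z
  proof -
    have "Determinant.det (Matrix.mat N N (\<lambda>(i, k). if k < N then \<phi> k (z i) else 0)) =
        (\<Sum>p\<in>?P. signof p * (\<Prod>i = 0..<N. \<phi> (p i) (z i)))"
      using perm by (subst det_def') (auto intro!: sum.cong prod.cong)
    then show ?thesis
      by (simp add: kernel_det_eq_square power2_eq_square sum_product prod.distrib mult_ac)
  qed
  then have expand: "kernel_det N = (\<lambda>z. \<Sum>p\<in>?P. \<Sum>r\<in>?P. (signof p * signof r) *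
      (\<Prod>i = 0..<N. \<phi> (p i) (z i) * \<phi> (r i) (z i)))" by blast
  show ?thesis
    unfolding expand by (intro Bochner_Integration.integrable_sum integrable_mult_right int)
qed

text \<open>Downward induction from \<open>n = N\<close>: with variable \<open>n\<close> outermost,
  the induction hypothesis at the updated point \<open>x(n := t n)\<close> evaluates the inner
  integral, and the outer one adds the factor \<open>N - n\<close> of the factorial.\<close>

lemma kernel_det_integral_tail:
  assumes "n \<le> N"
  shows "(LINT y|(\<Pi>\<^sub>M i\<in>{n..<N}. M). kernel_det N (merge {..<n} {n..<N} (x, y))) =
    fact (N - n) * kernel_det n x"
  using assms
proof (induction arbitrary: x rule: inc_induct)
  case base
  interpret product_sigma_finite "\<lambda>_::nat. M" ..
  have "kernel_det N (merge {..<N} {} (x, y)) = kernel_det N x" for y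
    by (rule kernel_det_cong) (simp add: merge_def)
  then show ?case by (simp add: PiM_empty lebesgue_integral_count_space_finite)
next
  case (step n)
  interpret product_sigma_finite "\<lambda>_::nat. M" ..
  let ?F = "\<lambda>y. kernel_det N (merge {..<n} {n..<N} (x, y))"
  have set_eq: "{n..<N} = {n} \<union> {Suc n..<N}" using step.hyps by auto
  have inner: "(LINT y|(\<Pi>\<^sub>M i\<in>{Suc n..<N}. M). ?F (merge {n} {Suc n..<N} (t, y))) =
      fact (N - Suc n) * kernel_det (Suc n) (x(n := t n))" for t
  proof -
    have "?F (merge {n} {Suc n..<N} (t, y)) =
        kernel_det N (merge {..<Suc n} {Suc n..<N} (x(n := t n), y))" for y
      by (rule kernel_det_cong) (auto simp: merge_def)
    then show ?thesis by (simp only: step.IH)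
  qed
  have "(LINT y|(\<Pi>\<^sub>M i\<in>{n..<N}. M). ?F y) =
      (LINT t|(\<Pi>\<^sub>M i\<in>{n}. M). LINT y|(\<Pi>\<^sub>M i\<in>{Suc n..<N}. M). ?F (merge {n} {Suc n..<N} (t, y)))"
    using product_integral_fold[of "{n}" "{Suc n..<N}" ?F] kernel_det_integrable[of n x]
    by (simp only: set_eq[symmetric]) auto
  also have "\<dots> = (LINT t|(\<Pi>\<^sub>M i\<in>{n}. M). fact (N - Suc n) * kernel_det (Suc n) (x(n := t n)))"
    by (simp only: inner)
  also have "\<dots> = (LINT s|M. fact (N - Suc n) * kernel_det (Suc n) (x(n := s)))"
    using kernel_det_integral_last[of n x]
    by (intro product_integral_singleton borel_measurable_times borel_measurable_const)
       (auto simp: has_bochner_integral_iff dest: borel_measurable_integrable)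
  also have "\<dots> = fact (N - Suc n) * ((real N - real n) * kernel_det n x)"
    using kernel_det_integral_last[of n x] by (simp add: has_bochner_integral_iff)
  also have "\<dots> = fact (N - n) * kernel_det n x"
  proof -
    have "N - n = Suc (N - Suc n)" using step.hyps by simp
    then have "(fact (N - n) :: real) = (real N - real n) * fact (N - Suc n)"
      using step.hyps by (simp add: of_nat_diff)
    then show ?thesis by simp
  qed
  finally show ?case .
qed

text \<open>The constant \<open>c\<close> cancels between the density and its normalizing integral
  \<open>fact N / c\<close>, and the factorials cancel against the prefactor.\<close>

lemma marginal_eq_kernel_det:
  assumes c: "c \<noteq> 0" "\<And>x. kernel_det N x = c * f x" and n: "n \<le> N"
  shows "fact N / fact (N - n) *
      (LINT y|(\<Pi>\<^sub>M i\<in>{n..<N}. M). f (merge {..<n} {n..<N} (x, y)) /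
        (LINT z|(\<Pi>\<^sub>M i\<in>{..<N}. M). f z)) = kernel_det n x"
proof -
  have f: "f z = kernel_det N z / c" for z using c by simp
  \<comment> \<open>This is the tail integral for \<open>n = 0\<close>, where the empty determinant
    is 1; no coordinate of \<open>undefined\<close> is read.\<close>
  have "(LINT z|(\<Pi>\<^sub>M i\<in>{..<N}. M). kernel_det N z) =
      (LINT y|(\<Pi>\<^sub>M i\<in>{0..<N}. M). kernel_det N (merge {..<0} {0..<N} (undefined, y)))"
    unfolding lessThan_atLeast0
    by (intro Bochner_Integration.integral_cong refl kernel_det_cong) (simp add: merge_def)
  also have "\<dots> = fact N"
    by (subst kernel_det_integral_tail) (auto simp: kernel_det_def)
  finally have Z: "(LINT z|(\<Pi>\<^sub>M i\<in>{..<N}. M). f z) = fact N / c"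
    by (simp add: f)
  show ?thesis
    unfolding Z using c(1) kernel_det_integral_tail[OF n, of x] by (simp add: f)
qed

end

section \<open>Specialization to the GUE weight\<close>

theorem proposition6:
  fixes N n :: nat
    and q :: "nat \<Rightarrow> real poly"
    and x :: "nat \<Rightarrow> real"
  assumes "N \<ge> 1"
    and "orthogonal_polynomials (gue_weight N) q"
    and "n \<ge> 1"
  shows "gue_correlation N n x =
           Determinant.det (Matrix.mat n n (\<lambda>(i, j). gue_kernel N q (x i) (x j)))"
proof -
  let ?w = "gue_weight N"
  define \<phi> where "\<phi> k t = sqrt (?w t) * poly (q k) t" for k t
  have deg: "degree (q k) = k" and lead_pos: "lead_coeff (q k) > 0"
    and orth: "has_bochner_integral lborel (\<lambda>t. ?w t * poly (q k) t * poly (q l) t) (of_bool (k = l))"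
    for k l
    using assms(2) unfolding orthogonal_polynomials_def of_bool_def by blast+
  have w_pos: "?w t > 0" for t by (simp add: gue_weight_def)
  have "\<phi> k t * \<phi> l t = ?w t * poly (q k) t * poly (q l) t" for k l t
    using real_sqrt_mult_self[of "?w t"] w_pos[of t]
    by (simp add: \<phi>_def mult_ac)
  then interpret orthonormal_functions lborel \<phi> N
    by unfold_locales (simp add: orth)
  have kernel: "gue_kernel N q s t = kernel s t" for s t
    by (simp add: gue_kernel_def kernel_def \<phi>_def sum_distrib_left mult_ac)
  \<comment> \<open>The leading coefficients come from the Vandermonde formula, the square from
    \<open>kernel_det N\<close> being a squared determinant.\<close>
  define c where "c = (\<Prod>k<N. lead_coeff (q k))\<^sup>2"
  have "c > 0" unfolding c_def by (intro zero_less_power prod_pos ballI lead_pos)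
  then have c: "c \<noteq> 0" by simp
  have square: "kernel_det N z = c * gue_unnormalized N z" for z
  proof -
    have "Matrix.mat N N (\<lambda>(i, k). if k < N then \<phi> k (z i) else 0) =
        Matrix.mat N N (\<lambda>(i, k). sqrt (?w (z i)) * poly (q k) (z i))"
      by (rule eq_matI) (auto simp: \<phi>_def)
    \<comment> \<open>Each row has a common factor, the root of the weight; squaring restores the
      weight itself.\<close>
    also have "Determinant.det \<dots> = (\<Prod>i<N. sqrt (?w (z i))) *
        Determinant.det (Matrix.mat N N (\<lambda>(i, k). poly (q k) (z i)))"
      by (rule det_mat_mult_rows)
    finally show ?thesis
      using det_poly_eq_Vandermonde[of N q z] deg w_pos
      by (simp add: kernel_det_eq_square c_def gue_unnormalized_def power_mult_distrib
          prod_power_distrib gue_weight_def mult_ac)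
  qed
  show ?thesis
  proof (cases "n \<le> N")
    case True
    then show ?thesis
      using marginal_eq_kernel_det[OF c square True, of x]
      by (simp add: gue_correlation_def gue_density_def gue_Z_def kernel_det_def kernel)
  next
    case False
    then show ?thesis
      using kernel_det_eq_0[of n x] by (simp add: gue_correlation_def kernel_det_def kernel)
  qed
qed

end
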